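(* Let $k\ge 2$ and $\ell\ge 1$ be integers. Let $d(i)_{i\ge 0}$ and $u(i)_{i\ge0}$ be periodic integer sequences with period lengths $\ell$ and $k\ell$, respectively. Let $r,s$ be nonnegative integers such that $r-s+k-1\ge 0$. Let $w(i)_{i\ge 0}$ be an integer sequence such that, for all $0\le m\le k-1$ and all $i\ge 0$, \[ w(ki+r+m) = \begin{cases} u(ki+m) & \text{if } 0\le m\le k-2,\\ w(i+s)+d(i) & \text{if } m=k-1.\end{cases} \] Then $w(i)_{i\ge 0}$ is $k$-regular.
   Context: For an integer $k\ge 2$ and a sequence $s(i)_{i\ge0}$, the $k$-kernel of $s$ is the set of subsequences $\{ s(k^e i + j)_{i\ge 0} : e\ge 0,\ 0\le j\le k^e-1\}$. The sequence is $k$-regular if the $\mathbb{Q}$-vector space spanned by its $k$-kernel is finite-dimensional. *)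

theory Defs
  imports Complex_Main "HOL-Library.Function_Algebras"
begin

definition seq_scale :: "rat \<Rightarrow> (nat \<Rightarrow> rat) \<Rightarrow> nat \<Rightarrow> rat" where
  "seq_scale c s = (\<lambda>i. c * s i)"

text \<open>Vector addition is the pointwise addition of functions from
  \<^theory>\<open>HOL-Library.Function_Algebras\<close>.\<close>

interpretation rat_seq: vector_space seq_scale
  by unfold_locales (auto simp: seq_scale_def fun_eq_iff algebra_simps)

definition k_kernel :: "nat \<Rightarrow> (nat \<Rightarrow> 'a) \<Rightarrow> (nat \<Rightarrow> 'a) set" where
  "k_kernel k s = {(\<lambda>i. s (k ^ e * i + j)) | e j. j < k ^ e}"

text \<open>Finite-dimensionality of the span is the existence of a finite basis. The library
  constant \<^const>\<open>rat_seq.dim\<close> is no substitute: it also takes the value 0 on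
  infinite-dimensional subspaces.\<close>

definition k_regular :: "nat \<Rightarrow> (nat \<Rightarrow> rat) \<Rightarrow> bool" where
  "k_regular k s \<longleftrightarrow>
     (\<exists>B. finite B \<and> rat_seq.independent B \<and> rat_seq.span B = rat_seq.span (k_kernel k s))"

text \<open>The period need not be the least one.\<close>

definition has_period :: "nat \<Rightarrow> (nat \<Rightarrow> 'a) \<Rightarrow> bool" where
  "has_period p s \<longleftrightarrow> (\<forall>i. s (i + p) = s i)"

end

theory Submission
  imports Defs
begin

text \<open>Let \<open>w\<^sub>a(i) = w(i + a)\<close>. Writing \<open>j + a - r = k q + m\<close> with \<open>0 \<le> m < k\<close>, the recurrence
  turns \<open>w\<^sub>a(k i + j)\<close> into a periodic sequence, or into \<open>w\<^sub>b(i)\<close> plus a periodic sequence with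
  \<open>b = q + s\<close>, up to the finitely many \<open>i\<close> with \<open>i + q < 0\<close>. Since \<open>k \<ge> 2\<close>, the map
  from \<open>a\<close> to \<open>b\<close> contracts, so the shifts stay in a bounded range. Hence finitely many
  shifts of \<open>w\<close>, the periodic sequences and the sequences with support in a fixed finite range span
  a finite-dimensional space that contains the \<open>k\<close>-kernel.\<close>

text \<open>Taking a section \<open>\<lambda>i. f (k * i + j)\<close> is linear in \<open>f\<close>,
  so closure on the generators in \<open>F\<close> extends to \<open>span F\<close>. Every element
  of the kernel is an iterated section of \<open>s\<close>, hence the whole kernel lies in a
  finitely generated space.\<close>

lemma k_regularI:
  assumes fin: "finite F" and s: "s \<in> rat_seq.span F"
    and closed: "\<And>f j. f \<in> F \<Longrightarrow> j < k \<Longrightarrow> (\<lambda>i. f (k * i + j)) \<in> rat_seq.span F"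
  shows "k_regular k s"
proof -
  have section_span: "(\<lambda>i. f (k * i + j)) \<in> rat_seq.span F" if "f \<in> rat_seq.span F" "j < k" for f j
    using that(1)
  proof (induction rule: rat_seq.span_induct_alt)
    case base
    then show ?case using rat_seq.span_zero[of F] by (simp add: zero_fun_def)
  next
    case (step c x y)
    have "(\<lambda>i. (seq_scale c x + y) (k * i + j))
        = seq_scale c (\<lambda>i. x (k * i + j)) + (\<lambda>i. y (k * i + j))"
      by (auto simp: seq_scale_def)
    with step closed[OF step(1) that(2)] show ?case
      by (simp add: rat_seq.span_add rat_seq.span_scale)
  qed
  have kernel: "(\<lambda>i. s (k ^ e * i + j)) \<in> rat_seq.span F" if "j < k ^ e" for e j
    using that
  proof (induction e arbitrary: j)
    case 0
    then show ?case using s by simp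
  next
    case (Suc e)
    \<comment> \<open>\<open>q\<close> is the leading base-\<open>k\<close> digit of
      \<open>j\<close>: since \<open>k ^ Suc e * i + j = k ^ e * (k * i + q) + t\<close>, the new
      subsequence is the \<open>q\<close>-section of one from level \<open>e\<close>.\<close>
    define q t where "q = j div k ^ e" and "t = j mod k ^ e"
    have "k ^ e > 0" using Suc.prems by (cases "k = 0") auto
    then have t: "t < k ^ e" and q: "q < k" and j: "j = k ^ e * q + t"
      using Suc.prems by (auto simp: q_def t_def less_mult_imp_div_less)
    have "(\<lambda>i. s (k ^ Suc e * i + j)) = (\<lambda>i. (\<lambda>i. s (k ^ e * i + t)) (k * i + q))"
      by (simp add: j algebra_simps)
    then show ?case using section_span[OF Suc.IH[OF t] q] by simp
  qed
  obtain B where B: "B \<subseteq> k_kernel k s" "rat_seq.independent B" "k_kernel k s \<subseteq> rat_seq.span B"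
    using rat_seq.maximal_independent_subset by metis
  have "k_kernel k s \<subseteq> rat_seq.span F"
    using kernel by (auto simp: k_kernel_def)
  with B fin have "finite B"
    by (meson rat_seq.independent_span_bound subset_trans)
  moreover have "rat_seq.span B = rat_seq.span (k_kernel k s)"
    using B by (metis rat_seq.span_mono rat_seq.span_minimal rat_seq.subspace_span subset_antisym)
  ultimately show ?thesis using B(2) unfolding k_regular_def by blast
qed

definition periodic_basis :: "nat \<Rightarrow> (nat \<Rightarrow> rat) set" where
  "periodic_basis N = (\<lambda>c i. of_bool (i mod N = c)) ` {..<N}"

definition delta_basis :: "nat \<Rightarrow> (nat \<Rightarrow> rat) set" where
  "delta_basis T = (\<lambda>t i. of_bool (i = t)) ` {..<T}"

lemma has_period_mod:
  assumes "has_period N f"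
  shows "f (i mod N) = f i"
proof -
  have "f (a + N * q) = f a" for a q
  proof (induction q)
    case (Suc q)
    have "f (a + N * Suc q) = f ((a + N * q) + N)" by (simp add: ac_simps)
    then show ?case using assms Suc by (simp only: has_period_def)
  qed simp
  from this[of "i mod N" "i div N"] show ?thesis by simp
qed

lemma sum_seq_apply: "(\<Sum>a\<in>A. f a) (i::nat) = (\<Sum>a\<in>A. (f a i :: rat))"
  by (induction A rule: infinite_finite_induct) auto

lemma has_period_in_span:
  assumes "has_period N f" and "N > 0"
  shows "f \<in> rat_seq.span (periodic_basis N)"
proof -
  have "f = (\<Sum>c<N. seq_scale (f c) (\<lambda>i. of_bool (i mod N = c)))"
  proof
    fix i
    have "(\<Sum>c<N. seq_scale (f c) (\<lambda>i. of_bool (i mod N = c))) i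
        = (\<Sum>c<N. if c = i mod N then f c else 0)"
      unfolding sum_seq_apply by (intro sum.cong) (auto simp: seq_scale_def)
    also have "\<dots> = f i"
      using assms(2) by (simp add: has_period_mod[OF assms(1)])
    finally show "f i = (\<Sum>c<N. seq_scale (f c) (\<lambda>i. of_bool (i mod N = c))) i" ..
  qed
  also have "\<dots> \<in> rat_seq.span (periodic_basis N)"
    by (intro rat_seq.span_sum rat_seq.span_scale rat_seq.span_base) (auto simp: periodic_basis_def)
  finally show ?thesis .
qed

lemma finite_support_in_span:
  assumes "\<And>i. i \<ge> T \<Longrightarrow> f i = 0"
  shows "f \<in> rat_seq.span (delta_basis T)"
proof -
  have "f = (\<Sum>t<T. seq_scale (f t) (\<lambda>i. of_bool (i = t)))"
  proof
    fix i
    have "(\<Sum>t<T. seq_scale (f t) (\<lambda>i. of_bool (i = t))) i = (\<Sum>t<T. if t = i then f t else 0)"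
      unfolding sum_seq_apply by (intro sum.cong) (auto simp: seq_scale_def)
    also have "\<dots> = f i"
      using assms by (simp add: not_less)
    finally show "f i = (\<Sum>t<T. seq_scale (f t) (\<lambda>i. of_bool (i = t))) i" ..
  qed
  also have "\<dots> \<in> rat_seq.span (delta_basis T)"
    by (intro rat_seq.span_sum rat_seq.span_scale rat_seq.span_base) (auto simp: delta_basis_def)
  finally show ?thesis .
qed

text \<open>Moving \<open>i\<close> by \<open>N\<close> moves the argument by \<open>k * N\<close>,
  again a multiple of \<open>N\<close>. So one fixed \<open>N\<close> serves all sections.\<close>

lemma has_period_section:
  assumes "has_period N f"
  shows "has_period N (\<lambda>i. f (k * i + j))"
  unfolding has_period_def
proof
  fix i
  have "(k * (i + N) + j) mod N = (k * i + j) mod N"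
    using mod_mult_self1[of "k * i + j" k N] by (simp add: algebra_simps)
  then show "f (k * (i + N) + j) = f (k * i + j)"
    using has_period_mod[OF assms] by metis
qed

text \<open>This allows identities to be checked only for large \<open>i\<close>, where all shifted
  indices are nonnegative.\<close>

lemma eventually_eq_in_span:
  assumes "g \<in> rat_seq.span F" "delta_basis T \<subseteq> F" "\<And>i. i \<ge> T \<Longrightarrow> f i = g i"
  shows "f \<in> rat_seq.span F"
proof -
  have "f - g \<in> rat_seq.span (delta_basis T)"
    by (rule finite_support_in_span) (simp add: assms(3))
  then have "f - g \<in> rat_seq.span F"
    using rat_seq.span_mono[OF assms(2)] by blast
  from rat_seq.span_add[OF this assms(1)] show ?thesis by simp
qed

text \<open>Dividing by \<open>k\<close> at least halves the shift, up to an additive error: the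
  upper bound needs about \<open>A/2 + s \<le> A\<close>, the lower one about
  \<open>(A + r)/2 \<le> A\<close>. The choice of \<open>A\<close> meets both.\<close>

lemma shift_bounds:
  fixes a q r s k j :: int
  assumes "k \<ge> 2" "0 \<le> j" "j < k" "r \<ge> 0" "s \<ge> 0"
    and "A = r + 2 * s + 2" "- A \<le> a" "a \<le> A" and q: "q = (j + a - r) div k"
  shows "- A \<le> q" "q + s \<le> A"
proof -
  obtain m where m: "k * q + m = j + a - r" "0 \<le> m" "m < k"
  proof
    show "k * q + (j + a - r) mod k = j + a - r" "0 \<le> (j + a - r) mod k" "(j + a - r) mod k < k"
      using assms(1) by (simp_all add: q)
  qed
  have "k * q \<le> A - 1 + k" "- (k * q) \<le> A + r - 1 + k"
    using m assms(2-4,7,8) by linarith+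
  \<comment> \<open>Absorbing the summand \<open>k\<close> into the left side leaves bounds free of
    \<open>k\<close> on the right, so that the factor \<open>k\<close> can be replaced by 2.\<close>
  then have up: "k * (q - 1) \<le> A - 1" and low: "k * (- q - 1) \<le> A + r - 1"
    by (simp_all add: right_diff_distrib)
  show "q + s \<le> A"
  proof (cases "q - 1 \<ge> 0")
    case True
    then have "2 * (q - 1) \<le> k * (q - 1)" using assms(1) by (intro mult_right_mono) auto
    then show ?thesis using order_trans[OF _ up] assms(4-6) by force
  qed (use assms(4-6) in linarith)
  show "- A \<le> q"
  proof (cases "- q - 1 \<ge> 0")
    case True
    then have "2 * (- q - 1) \<le> k * (- q - 1)" using assms(1) by (intro mult_right_mono) auto
    then show ?thesis using order_trans[OF _ low] assms(4-6) by force
  qed (use assms(4-6) in linarith)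
qed

theorem theorem1p6:
  fixes k l r s :: nat and d u w :: "nat \<Rightarrow> int"
  assumes "k \<ge> 2" and "l \<ge> 1"
    and "has_period l d" and "has_period (k * l) u"
    and "int r - int s + int k - 1 \<ge> 0"
    and "\<And>m i. m \<le> k - 1 \<Longrightarrow>
           w (k * i + r + m) = (if m \<le> k - 2 then u (k * i + m) else w (i + s) + d i)"
  shows "k_regular k (\<lambda>i. rat_of_int (w i))"
proof -
  define A where "A = r + 2 * s + 2"
  define N where "N = k * l"
  \<comment> \<open>For negative \<open>a\<close>, \<open>nat\<close> replaces the indices below 0
    by 0. This affects only \<open>i < -a\<close>, a range within the support of
    \<open>delta_basis A\<close> when \<open>-a \<le> A\<close>.\<close>
  define W where "W = (\<lambda>a i. rat_of_int (w (nat (int i + a))))"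
  define F where "F = W ` {- int A..int A} \<union> periodic_basis N \<union> delta_basis A"
  have N: "N > 0" using assms by (simp add: N_def)
  have pF: "periodic_basis N \<subseteq> F" and dF: "delta_basis A \<subseteq> F" by (auto simp: F_def)
  have periodic: "f \<in> rat_seq.span F" if "has_period N f" for f
    using has_period_in_span[OF that N] rat_seq.span_mono[OF pF] by blast
  have section_W: "(\<lambda>i. W a (k * i + j)) \<in> rat_seq.span F"
    if a: "- int A \<le> a" "a \<le> int A" and j: "j < k" for a j
  proof -
    define q m where "q = (int j + a - int r) div int k" and "m = nat ((int j + a - int r) mod int k)"
    have "int A = int r + 2 * int s + 2" by (simp add: A_def)
    then have q: "- int A \<le> q" "q + int s \<le> int A"
      using shift_bounds[of "int k" "int j" "int r" "int s" "int A" a q] assms(1) a j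
      by (auto simp: q_def)
    have m: "m < k" and qm: "int j + a = int k * q + int r + int m"
    proof -
      have "int m = (int j + a - int r) mod int k"
        unfolding m_def using assms(1) by simp
      then show "m < k" "int j + a = int k * q + int r + int m"
        using assms(1) mult_div_mod_eq[of "int k" "int j + a - int r"]
        by (auto simp: q_def nat_less_iff m_def)
    qed
    \<comment> \<open>For \<open>i \<ge> A\<close> the bound \<open>q \<ge> -A\<close> gives
      \<open>i + q \<ge> 0\<close>, so \<open>nat\<close> is exact and the recurrence applies at
      index \<open>i + q\<close>.\<close>
    have WI: "W a (k * i + j) = rat_of_int (if m \<le> k - 2 then u (k * nat (int i + q) + m)
        else w (nat (int i + q) + s) + d (nat (int i + q)))" if "i \<ge> A" for i
    proof -
      have "int (k * i + j) + a = int (k * nat (int i + q) + r + m)"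
        using q that qm by (simp add: algebra_simps)
      then have "nat (int (k * i + j) + a) = k * nat (int i + q) + r + m" by linarith
      then show ?thesis using assms(6)[of m "nat (int i + q)"] m by (simp add: W_def)
    qed
    \<comment> \<open>adding a multiple of \<open>N\<close> to \<open>q\<close> makes the shift nonnegative without changing
      the values of sequences of period \<open>N\<close>\<close>
    define p where "p = nat (q + int N * int A)"
    have "int A \<le> int N * int A" using N by (simp flip: of_nat_mult)
    then have p: "int p = q + int N * int A" using q(1) by (simp add: p_def)
    have ip: "i + p = nat (int i + q) + N * A" if "i \<ge> A" for i
      proof -
      have "int (i + p) = int (nat (int i + q) + N * A)" using that q(1) p by simp
      then show ?thesis by (simp only: of_nat_eq_iff)
    qed
    show ?thesis
    proof (cases "m \<le> k - 2")
      case True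
      have "has_period N (\<lambda>i. rat_of_int (u (k * i + (k * p + m))))"
        using has_period_section[OF assms(4), of k "k * p + m"] by (simp add: has_period_def N_def)
      then show ?thesis
      proof (rule eventually_eq_in_span[OF periodic dF])
        fix i assume i: "A \<le> i"
        have "k * i + (k * p + m) = k * nat (int i + q) + m + (k * A) * N"
          using arg_cong[OF ip[OF i], of "\<lambda>x. k * x + m"] by (simp add: algebra_simps)
        then have "(k * i + (k * p + m)) mod N = (k * nat (int i + q) + m) mod N"
          by (simp only: mod_mult_self1)
        then have "u (k * i + (k * p + m)) = u (k * nat (int i + q) + m)"
          using has_period_mod[OF assms(4)[folded N_def]] by metis
        then show "W a (k * i + j) = rat_of_int (u (k * i + (k * p + m)))"
          using WI[OF i] True by simp
      qed
    next
      case False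
      have dN: "has_period N d"
        unfolding has_period_def N_def
      proof
        fix i
        show "d (i + k * l) = d i"
          using has_period_mod[OF assms(3), of "i + k * l"] has_period_mod[OF assms(3), of i] by simp
      qed
      have "has_period N (\<lambda>i. rat_of_int (d (i + p)))"
        using has_period_section[OF dN, of 1 p] by (simp add: has_period_def)
      moreover have "W (q + int s) \<in> rat_seq.span F"
        using q by (intro rat_seq.span_base) (auto simp: F_def)
      ultimately have "W (q + int s) + (\<lambda>i. rat_of_int (d (i + p))) \<in> rat_seq.span F"
        by (blast intro: rat_seq.span_add periodic)
      then show ?thesis
      proof (rule eventually_eq_in_span[OF _ dF])
        fix i assume i: "A \<le> i"
        have "(i + p) mod N = nat (int i + q) mod N" using ip[OF i] by simp
        then have "d (i + p) = d (nat (int i + q))"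
          using has_period_mod[OF dN] by metis
        moreover have "nat (int i + q) + s = nat (int i + (q + int s))"
          using q(1) i by linarith
        ultimately show "W a (k * i + j) = (W (q + int s) + (\<lambda>i. rat_of_int (d (i + p)))) i"
          using WI[OF i] False by (simp add: W_def)
      qed
    qed
  qed
  show ?thesis
  proof (rule k_regularI)
    show "finite F" by (simp add: F_def periodic_basis_def delta_basis_def)
    have "(\<lambda>i. rat_of_int (w i)) = W 0" by (simp add: W_def)
    also have "\<dots> \<in> rat_seq.span F" by (intro rat_seq.span_base) (simp add: F_def)
    finally show "(\<lambda>i. rat_of_int (w i)) \<in> rat_seq.span F" .
  next
    fix f j assume "f \<in> F" and j: "j < k"
    then consider a where "f = W a" "- int A \<le> a" "a \<le> int A"
      | "f \<in> periodic_basis N" | "f \<in> delta_basis A"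
      by (auto simp: F_def)
    then show "(\<lambda>i. f (k * i + j)) \<in> rat_seq.span F"
    proof cases
      case 1
      then show ?thesis using section_W j by simp
    next
      case 2
      then have "has_period N f" by (auto simp: periodic_basis_def has_period_def)
      then show ?thesis by (intro periodic has_period_section)
    next
      case 3
      \<comment> \<open>A section of a sequence supported below \<open>A\<close> is supported below
        \<open>A\<close> too, because \<open>k * i + j \<ge> i\<close>; it is therefore compared
        with 0.\<close>
      show ?thesis
      proof (rule eventually_eq_in_span[OF rat_seq.span_zero dF])
        fix i assume "A \<le> i"
        moreover have "i \<le> k * i" using assms(1) by simp
        ultimately have "A \<le> k * i + j" by linarith
        then show "f (k * i + j) = 0 i" using 3 by (auto simp: delta_basis_def)
      qed
    qed
  qed
qed

end
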